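(* Let $n\ge 1$, $p\in(0,1)$, $q=1-p$, and let $A\subseteq[0,n-1]$ be random, each element of $[0,n-1]$ included in $A$ independently with probability $p$. For $0\le i\le n-1$ and $0\le r\le n$ write $P_r(i):=\mathbb{P}(i\notin A+A \mid |A|=r)$. Then $$\mathbb{E}[|A+A|]=\sum_{r=0}^{n}\binom{n}{r}p^r q^{n-r}\left(2\sum_{i=0}^{n-2}\bigl(1-P_r(i)\bigr)+\bigl(1-P_r(n-1)\bigr)\right),$$ where $$P_r(i)=\begin{cases}\dfrac{\sum_{k=0}^{(i+1)/2}2^k\binom{(i+1)/2}{k}\binom{n-i-1}{r-k}}{\binom{n}{r}} & \text{if } i \text{ is odd},\\[3mm] \dfrac{\sum_{k=0}^{i/2}2^k\binom{i/2}{k}\binom{n-i-1}{r-k}}{\binom{n}{r}} & \text{if } i \text{ is even}.\end{cases}$$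
   Context: $[a,b]$ denotes the set of integers $\{a,a+1,\dots,b\}$. $A+A=\{a+a' : a,a'\in A\}$. Binomial coefficients follow the convention $\binom{m}{j}=0$ when $j<0$ or $j>m$. *)

theory Defs
  imports "HOL-Probability.Probability" "HOL-Library.Set_Algebras"
begin

text \<open>The lower index is an integer: in \<open>n - i - 1\<close> choose \<open>r - k\<close> the difference
  \<open>r - k\<close> may be negative, and truncated subtraction on \<^typ>\<open>nat\<close> would then yield 1
  instead of 0.  Lower indices exceeding \<open>m\<close> already give 0 in \<^const>\<open>binomial\<close>.\<close>

definition binom :: "nat \<Rightarrow> int \<Rightarrow> nat" where
  "binom m j = (if j < 0 then 0 else m choose nat j)"

text \<open>The paper's \<open>P\<^sub>r(i)\<close>, for a random set \<open>A\<close> on the probability space \<open>M\<close>.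
  \<open>A \<omega> + A \<omega>\<close> is the sumset of \<^theory>\<open>HOL-Library.Set_Algebras\<close>.\<close>

definition missing_prob :: "'a measure \<Rightarrow> ('a \<Rightarrow> nat set) \<Rightarrow> nat \<Rightarrow> nat \<Rightarrow> real" where
  "missing_prob M A r i = cond_prob M (\<lambda>\<omega>. i \<notin> A \<omega> + A \<omega>) (\<lambda>\<omega>. card (A \<omega>) = r)"

end

theory Submission
  imports Defs
begin

text \<open>Conditioned on its size \<open>r\<close>, the random set \<open>A\<close> is uniform on the \<open>r\<close>-subsets of
  \<open>[0,n-1]\<close>, so \<open>P\<^sub>r(i)\<close> counts the \<open>r\<close>-subsets \<open>B\<close> with \<open>i \<notin> B + B\<close>.  Such a \<open>B\<close> contains
  at most one element of each pair \<open>{h, i - h}\<close> (and not the midpoint \<open>i/2\<close>, if \<open>i\<close> is even) and is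
  arbitrary above \<open>i\<close>: choose the \<open>k\<close> pairs met by \<open>B\<close>, one of two elements of each, and \<open>r - k\<close>
  elements above \<open>i\<close>.  The reflection \<open>x \<mapsto> n - 1 - x\<close> identifies the counts for \<open>i\<close> and
  \<open>2(n-1) - i\<close>, which yields the factor 2 in the expectation.\<close>

section \<open>Distribution of the random set\<close>

text \<open>The event \<open>A \<omega> = B\<close> is the intersection over
  \<open>i \<in> I\<close> of the events \<open>i \<in> A \<omega>\<close> (for
  \<open>i \<in> B\<close>) and their complements (for \<open>i \<notin> B\<close>). These are
  independent, so the probability is a product of factors \<open>p\<close> and
  \<open>1 - p\<close>.\<close>

lemma (in prob_space) prob_random_subset_eq:
  assumes fin: "finite I"
    and sub: "\<And>\<omega>. \<omega> \<in> space M \<Longrightarrow> A \<omega> \<subseteq> I"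
    and ind: "indep_events (\<lambda>i. {\<omega> \<in> space M. i \<in> A \<omega>}) I"
    and p: "\<And>i. i \<in> I \<Longrightarrow> prob {\<omega> \<in> space M. i \<in> A \<omega>} = p"
    and B: "B \<subseteq> I"
  shows "{\<omega> \<in> space M. A \<omega> = B} \<in> events"
    and "prob {\<omega> \<in> space M. A \<omega> = B} = p ^ card B * (1 - p) ^ (card I - card B)"
proof -
  define E where "E i = {\<omega> \<in> space M. i \<in> A \<omega>}" for i
  define F where "F i = (if i \<in> B then E i else space M - E i)" for i
  have E: "E i \<in> events" if "i \<in> I" for i
    using ind that by (auto simp: indep_events_def E_def)
  have F: "F i \<in> events" if "i \<in> I" for i
    using E[OF that] by (auto simp: F_def)
  have "A \<omega> = B \<longleftrightarrow> (\<forall>i\<in>I. \<omega> \<in> F i)" if "\<omega> \<in> space M" for \<omega>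
  proof -
    have "\<omega> \<in> F i \<longleftrightarrow> (i \<in> A \<omega> \<longleftrightarrow> i \<in> B)" for i
      using that by (simp add: F_def E_def)
    then show ?thesis using sub[OF that] B by blast
  qed
  \<comment> \<open>Intersecting with \<open>space M\<close> keeps the equation true for
    \<open>I = {}\<close>, where the indexed intersection is the whole type.\<close>
  then have eq: "{\<omega> \<in> space M. A \<omega> = B} = space M \<inter> (\<Inter>i\<in>I. F i)"
    by blast
  show "{\<omega> \<in> space M. A \<omega> = B} \<in> events"
  proof (cases "I = {}")
    case False
    then show ?thesis unfolding eq using fin F by (intro sets.Int sets.finite_INT) auto
  qed (simp add: eq)
  have "indep_sets (\<lambda>i. {E i}) I"
    using ind by (simp add: indep_events_def_alt E_def)
  \<comment> \<open>Passing to the generated sigma-algebras makes the complements of the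
    \<open>E i\<close> available as well; a singleton is trivially intersection-stable.\<close>
  then have ind': "indep_sets (\<lambda>i. sigma_sets (space M) {E i}) I"
    by (rule indep_sets_sigma) (simp add: Int_stable_def)
  have "prob {\<omega> \<in> space M. A \<omega> = B} = (\<Prod>i\<in>I. prob (F i))"
  proof (cases "I = {}")
    case False
    have "prob (\<Inter>i\<in>I. F i) = (\<Prod>i\<in>I. prob (F i))"
      using False fin by (intro indep_setsD[OF ind'])
        (auto simp: F_def intro: sigma_sets.Compl sigma_sets.Basic)
    moreover have "space M \<inter> (\<Inter>i\<in>I. F i) = (\<Inter>i\<in>I. F i)"
      using False F sets.sets_into_space by blast
    ultimately show ?thesis by (simp add: eq)
  qed (simp add: eq prob_space)
  also have "\<dots> = (\<Prod>i\<in>I. if i \<in> B then p else 1 - p)"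
    using E p by (intro prod.cong) (auto simp: F_def prob_compl E_def)
  also have "\<dots> = p ^ card B * (1 - p) ^ card (I - B)"
    using fin B by (subst prod.If_cases) (auto simp: Int_absorb1 Diff_eq)
  finally show "prob {\<omega> \<in> space M. A \<omega> = B} = p ^ card B * (1 - p) ^ (card I - card B)"
    using fin B by (simp add: card_Diff_subset finite_subset)
qed

text \<open>As \<open>A\<close> takes only finitely many values, \<open>g (A \<omega>)\<close> is a
  finite linear combination of indicators of the events \<open>A \<omega> = B\<close>, and it can be
  integrated term by term.\<close>

lemma (in prob_space) expectation_random_subset:
  fixes g :: "'i set \<Rightarrow> real"
  assumes fin: "finite I"
    and sub: "\<And>\<omega>. \<omega> \<in> space M \<Longrightarrow> A \<omega> \<subseteq> I"
    and ind: "indep_events (\<lambda>i. {\<omega> \<in> space M. i \<in> A \<omega>}) I"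
    and p: "\<And>i. i \<in> I \<Longrightarrow> prob {\<omega> \<in> space M. i \<in> A \<omega>} = p"
  shows "expectation (\<lambda>\<omega>. g (A \<omega>)) =
    (\<Sum>B\<in>Pow I. g B * (p ^ card B * (1 - p) ^ (card I - card B)))"
proof -
  note eq = prob_random_subset_eq[OF assms]
  have "expectation (\<lambda>\<omega>. g (A \<omega>)) =
      expectation (\<lambda>\<omega>. \<Sum>B\<in>Pow I. g B * indicator {\<omega> \<in> space M. A \<omega> = B} \<omega>)"
  proof (rule Bochner_Integration.integral_cong[OF refl])
    fix \<omega> assume "\<omega> \<in> space M"
    then have "(\<Sum>B\<in>Pow I. g B * indicator {\<omega> \<in> space M. A \<omega> = B} \<omega>) =
        (\<Sum>B\<in>Pow I. if A \<omega> = B then g B else 0)"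
      by (intro sum.cong) auto
    then show "g (A \<omega>) = (\<Sum>B\<in>Pow I. g B * indicator {\<omega> \<in> space M. A \<omega> = B} \<omega>)"
      using sub[OF \<open>\<omega> \<in> space M\<close>] fin by simp
  qed
  also have "\<dots> = (\<Sum>B\<in>Pow I. g B * prob {\<omega> \<in> space M. A \<omega> = B})"
    using eq(1) by (subst Bochner_Integration.integral_sum)
      (auto simp: Int_def intro!: integrable_mult_right integrable_real_indicator sum.cong
        simp: emeasure_eq_measure cong: conj_cong)
  also have "\<dots> = (\<Sum>B\<in>Pow I. g B * (p ^ card B * (1 - p) ^ (card I - card B)))"
    using eq(2) by (intro sum.cong) auto
  finally show ?thesis .
qed

text \<open>Take \<open>g\<close> to be the indicator of the sets of size \<open>r\<close>
  satisfying \<open>Q\<close>: all of them carry the same weight, so only their number matters. This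
  is the uniformity of \<open>A\<close> given its size.\<close>

lemma (in prob_space) prob_random_subset:
  fixes p :: real
  assumes "finite I"
    and "\<And>\<omega>. \<omega> \<in> space M \<Longrightarrow> A \<omega> \<subseteq> I"
    and "indep_events (\<lambda>i. {\<omega> \<in> space M. i \<in> A \<omega>}) I"
    and "\<And>i. i \<in> I \<Longrightarrow> prob {\<omega> \<in> space M. i \<in> A \<omega>} = p"
  shows "prob {\<omega> \<in> space M. Q (A \<omega>) \<and> card (A \<omega>) = r} =
    card {B. B \<subseteq> I \<and> card B = r \<and> Q B} * (p ^ r * (1 - p) ^ (card I - r))"
proof -
  let ?w = "p ^ r * (1 - p) ^ (card I - r)"
  have "prob {\<omega> \<in> space M. Q (A \<omega>) \<and> card (A \<omega>) = r} =
      expectation (indicator {\<omega> \<in> space M. Q (A \<omega>) \<and> card (A \<omega>) = r})"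
    by (simp add: Int_def conj_ac cong: conj_cong)
  also have "\<dots> = expectation (\<lambda>\<omega>. if Q (A \<omega>) \<and> card (A \<omega>) = r then 1 else 0)"
    by (intro Bochner_Integration.integral_cong) auto
  also have "\<dots> = (\<Sum>B\<in>Pow I. (if Q B \<and> card B = r then 1 else 0)
      * (p ^ card B * (1 - p) ^ (card I - card B)))"
    using expectation_random_subset[OF assms, of "\<lambda>B. if Q B \<and> card B = r then 1 else 0"] .
  also have "\<dots> = (\<Sum>B\<in>Pow I. if Q B \<and> card B = r then ?w else 0)"
    by (intro sum.cong) auto
  also have "\<dots> = (\<Sum>B\<in>{B. B \<subseteq> I \<and> card B = r \<and> Q B}. ?w)"
    using assms(1) by (intro sum.mono_neutral_cong_right) auto
  finally show ?thesis by simp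
qed

lemma sum_Pow_by_card:
  fixes g :: "'i set \<Rightarrow> 'b :: comm_monoid_add"
  assumes "finite X"
  shows "(\<Sum>B\<in>Pow X. g B) = (\<Sum>r=0..card X. \<Sum>B | B \<subseteq> X \<and> card B = r. g B)"
proof -
  have "(\<Sum>r=0..card X. \<Sum>B | B \<in> Pow X \<and> card B = r. g B) = (\<Sum>B\<in>Pow X. g B)"
    using assms by (intro sum.group) (auto intro: card_mono)
  then show ?thesis by simp
qed

section \<open>Counting the sets whose sumset misses a given number\<close>

definition missing_sets :: "nat \<Rightarrow> nat \<Rightarrow> nat \<Rightarrow> nat set set" where
  "missing_sets n r i = {B. B \<subseteq> {..<n} \<and> card B = r \<and> i \<notin> B + B}"

text \<open>Order the two summands: if they differ, the smaller one is some \<open>h\<close> with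
  \<open>2 * h < i\<close>, that is \<open>h < (i + 1) div 2\<close>; if they agree, they are the
  midpoint. The bound serves both parities of \<open>i\<close>.\<close>

lemma mem_sumset_iff:
  fixes B :: "nat set"
  shows "i \<in> B + B \<longleftrightarrow> (\<exists>h<(i + 1) div 2. h \<in> B \<and> i - h \<in> B) \<or> even i \<and> i div 2 \<in> B"
    (is "_ \<longleftrightarrow> ?P")
proof
  assume "i \<in> B + B"
  then obtain x y where xy: "x \<in> B" "y \<in> B" "i = x + y" by (auto simp: set_plus_def)
  consider "x < y" | "y < x" | "x = y" by linarith
  then show ?P
  proof cases
    case 1
    then show ?thesis using xy by (intro disjI1 exI[of _ x]) auto
  next
    case 2
    then show ?thesis using xy by (intro disjI1 exI[of _ y]) auto
  qed (use xy in auto)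
next
  assume ?P
  then show "i \<in> B + B"
  proof
    assume "\<exists>h<(i + 1) div 2. h \<in> B \<and> i - h \<in> B"
    then obtain h where h: "h < (i + 1) div 2" "h \<in> B" "i - h \<in> B" by auto
    then have "i = h + (i - h)" by linarith
    with h show ?thesis unfolding set_plus_def by blast
  next
    assume "even i \<and> i div 2 \<in> B"
    moreover from this have "i = i div 2 + i div 2" by auto
    ultimately show ?thesis unfolding set_plus_def by blast
  qed
qed

text \<open>With the integer lower index the count is also right for \<open>s > r\<close>, where
  both sides are 0.\<close>

lemma card_subsets_binom:
  assumes "finite X"
  shows "card {D. D \<subseteq> X \<and> s + card D = r} = binom (card X) (int r - int s)"
proof (cases "s \<le> r")
  case True
  then have "{D. D \<subseteq> X \<and> s + card D = r} = {D. D \<subseteq> X \<and> card D = r - s}" by auto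
  then show ?thesis using True assms by (simp add: binom_def n_subsets flip: of_nat_diff)
next
  case False
  then have "{D. D \<subseteq> X \<and> s + card D = r} = {}" by auto
  then show ?thesis using False by (simp add: binom_def)
qed

text \<open>A set \<open>B\<close> missing \<open>i\<close> is encoded by the set \<open>S\<close> of pairs \<open>{h, i - h}\<close>, \<open>h < m\<close>, that it
  meets, the set \<open>T \<subseteq> S\<close> of those that it meets in \<open>h\<close>, and its part \<open>D\<close> above \<open>i\<close>.\<close>

lemma card_missing_sets:
  fixes n r i :: nat
  defines "m \<equiv> (i + 1) div 2"
  assumes "i < n"
  shows "card (missing_sets n r i) =
    (\<Sum>k=0..m. 2 ^ k * binom m (int k) * binom (n - i - 1) (int r - int k))"
proof -
  define dec where "dec = (\<lambda>(S, T, D). T \<union> (\<lambda>h. i - h) ` (S - T) \<union> D :: nat set)"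
  define enc where "enc B = (B \<inter> {..<m} \<union> {h. h < m \<and> i - h \<in> B}, B \<inter> {..<m}, B \<inter> {i<..<n})"
    for B :: "nat set"
  \<comment> \<open>Each pair in \<open>S\<close> contributes exactly one element, whichever
    \<open>T\<close> is chosen; hence the size condition involves only \<open>S\<close> and
    \<open>D\<close>.\<close>
  define X where "X = (SIGMA S:Pow {..<m}. Pow S \<times> {D. D \<subseteq> {i<..<n} \<and> card S + card D = r})"
  \<comment> \<open>Reflection in \<open>i\<close> sends \<open>{..<m}\<close> injectively into
    \<open>{m..i}\<close>, so the three pieces of \<open>dec\<close> lie in disjoint ranges.\<close>
  have mi: "2 * h < i" "i - h > h" "\<not> i - h < m" "i - (i - h) = h" if "h < m" for h
    using that unfolding m_def by linarith+
  have [simp]: "i \<notin> B + B \<longleftrightarrow> (\<forall>h<m. h \<in> B \<longrightarrow> i - h \<notin> B) \<and> (even i \<longrightarrow> i div 2 \<notin> B)"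
    for B by (auto simp: mem_sumset_iff m_def)
  have card_dec: "card (dec (S, T, D)) = card S + card D"
    if "S \<subseteq> {..<m}" "T \<subseteq> S" "D \<subseteq> {i<..<n}" for S T D
  proof -
    have fin: "finite S" "finite T" "finite D"
      using that by (meson finite_subset finite_lessThan finite_greaterThanLessThan)+
    have inj: "inj_on (\<lambda>h. i - h) (S - T)"
      using that mi(4) by (intro inj_on_inverseI[where g = "\<lambda>h. i - h"]) auto
    have img: "(\<lambda>h. i - h) ` (S - T) \<subseteq> {m..i}"
      using that mi(3) by (auto simp: not_less)
    moreover have T: "T \<subseteq> {..<m}"
      using that by blast
    moreover have "{..<m} \<inter> {m..i} = {}"
      by auto
    ultimately have "T \<inter> (\<lambda>h. i - h) ` (S - T) = {}"
      by blast
    moreover have "{..<m} \<inter> {i<..<n} = {}" "{m..i} \<inter> {i<..<n} = {}"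
      by (auto simp: m_def)
    with T img that have "(T \<union> (\<lambda>h. i - h) ` (S - T)) \<inter> D = {}"
      by blast
    ultimately have "card (dec (S, T, D)) = card T + card (S - T) + card D"
      using fin by (simp add: dec_def card_Un_disjoint card_image[OF inj])
    then show ?thesis
      using that fin by (simp add: card_Diff_subset card_mono)
  qed
  have dec: "dec x \<in> missing_sets n r i \<and> enc (dec x) = x" if "x \<in> X" for x
  proof -
    obtain S T D where x: "x = (S, T, D)" by (cases x)
    have STD: "S \<subseteq> {..<m}" "T \<subseteq> S" "D \<subseteq> {i<..<n}" "card S + card D = r"
      using that by (auto simp: X_def x)
    have mem: "y \<in> dec x \<longleftrightarrow> y \<in> T \<or> (\<exists>h\<in>S - T. y = i - h) \<or> y \<in> D" for y
      by (auto simp: dec_def x)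
    have S: "h < m" if "h \<in> S" for h using STD that by auto
    have T: "h \<in> S" "h < m" if "h \<in> T" for h using STD that by auto
    have D: "i < d" "d < n" if "d \<in> D" for d using STD that by auto
    have mi': "h \<le> i" if "h < m" for h using mi(1)[OF that] by linarith
    \<comment> \<open>As \<open>T\<close> and \<open>S - T\<close> are disjoint, no pair lies
      entirely in \<open>dec x\<close>. The same equivalences let \<open>enc\<close> recover
      \<open>T\<close> and \<open>S\<close>.\<close>
    have low: "h \<in> dec x \<longleftrightarrow> h \<in> T" "i - h \<in> dec x \<longleftrightarrow> h \<in> S - T" if "h < m" for h
    proof -
      have "h \<noteq> i - s" if "s \<in> S" for s
        using mi(3)[OF S[OF that]] \<open>h < m\<close> by auto
      moreover have "h \<notin> D"
        using D(1)[of h] mi'[OF that] by linarith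
      ultimately show "h \<in> dec x \<longleftrightarrow> h \<in> T"
        unfolding mem by blast
      have "s = h" if "s \<in> S" "i - h = i - s" for s
        using mi(4)[OF S[OF that(1)]] mi(4)[OF \<open>h < m\<close>] that(2) by simp
      moreover have "i - h \<notin> T"
        using T(2)[of "i - h"] mi(3)[OF that] by blast
      moreover have "i - h \<notin> D"
        using D(1)[of "i - h"] by linarith
      ultimately show "i - h \<in> dec x \<longleftrightarrow> h \<in> S - T"
        unfolding mem by blast
    qed
    have high: "h \<in> dec x \<longleftrightarrow> h \<in> D" if "i < h" for h
    proof -
      have "h \<notin> T" using T(2)[of h] mi'[of h] that by linarith
      moreover have "h \<noteq> i - h'" for h' using that by linarith
      ultimately show ?thesis unfolding mem by blast
    qed
    have mid: "i div 2 \<notin> dec x" if "even i"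
    proof -
      have m: "m = i div 2" using that by (auto simp: m_def)
      have "i div 2 \<noteq> i - h" if "h \<in> S" for h
        using mi(1)[OF S[OF that]] by linarith
      moreover have "i div 2 \<notin> T" using T(2) m by blast
      moreover have "i div 2 \<notin> D" using D(1)[of "i div 2"] by linarith
      ultimately show ?thesis unfolding mem by blast
    qed
    have "y < n" if "y \<in> dec x" for y
    proof -
      consider "y \<in> T" | h where "y = i - h" | "y \<in> D" using \<open>y \<in> dec x\<close> unfolding mem by blast
      then show ?thesis
        using mi'[of y] T(2)[of y] D(2)[of y] \<open>i < n\<close> by cases linarith+
    qed
    then have "dec x \<subseteq> {..<n}" by auto
    then have "dec x \<in> missing_sets n r i"
      using low mid card_dec STD by (simp add: missing_sets_def x)
    moreover have "enc (dec x) = x"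
      using low high STD by (auto simp: enc_def x)
    ultimately show ?thesis by blast
  qed
  have enc: "enc B \<in> X \<and> dec (enc B) = B" if "B \<in> missing_sets n r i" for B
  proof -
    have B: "B \<subseteq> {..<n}" "card B = r" "\<And>h. h < m \<Longrightarrow> h \<in> B \<Longrightarrow> i - h \<notin> B"
        "even i \<Longrightarrow> i div 2 \<notin> B"
      using that by (auto simp: missing_sets_def)
    have "dec (enc B) = B"
    proof (intro set_eqI iffI)
      fix x assume "x \<in> dec (enc B)"
      then show "x \<in> B" by (auto simp: dec_def enc_def)
    next
      fix x assume x: "x \<in> B"
      \<comment> \<open>The ranges are the lower halves of the pairs, the part above
        \<open>i\<close>, the upper halves and the midpoint. The midpoint cannot lie in
        \<open>B\<close>; in an upper half, the partner \<open>i - x\<close> is outside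
        \<open>B\<close>, which puts it in \<open>S - T\<close>.\<close>
      consider "x < m" | "i < x" | "x \<le> i" "i - x < m" | "i = 2 * x"
        unfolding m_def by linarith
      then show "x \<in> dec (enc B)"
      proof cases
        case 3
        then have "i - x \<notin> B" "x = i - (i - x)" using B(3)[of "i - x"] x by auto
        then have "x \<in> (\<lambda>h. i - h) ` (B \<inter> {..<m} \<union> {h. h < m \<and> i - h \<in> B} - B \<inter> {..<m})"
          using 3 x by (intro image_eqI[of _ _ "i - x"]) auto
        then show ?thesis by (simp add: dec_def enc_def)
      qed (use x B in \<open>auto simp: dec_def enc_def\<close>)
    qed
    moreover have "enc B \<in> X"
    proof -
      obtain S T D where STD: "enc B = (S, T, D)" by (cases "enc B")
      then have sub: "S \<subseteq> {..<m}" "T \<subseteq> S" "D \<subseteq> {i<..<n}"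
        by (auto simp: enc_def)
      then have "card S + card D = r"
        using card_dec[OF sub] \<open>dec (enc B) = B\<close> B(2) by (simp add: STD)
      then show ?thesis using sub by (simp add: X_def STD)
    qed
    ultimately show ?thesis by blast
  qed
  have "card (missing_sets n r i) = card X"
    using dec enc by (intro bij_betw_same_card[where f = enc] bij_betw_byWitness[where f' = dec]) auto
  \<comment> \<open>For fixed \<open>S\<close> there are \<open>2 ^ card S\<close> choices of
    \<open>T\<close>, and \<open>D\<close> takes \<open>r - card S\<close> of the
    \<open>n - i - 1\<close> numbers in \<open>{i<..<n}\<close>.\<close>
  also have "\<dots> = (\<Sum>S\<in>Pow {..<m}. 2 ^ card S * binom (n - i - 1) (int r - int (card S)))"
    unfolding X_def
    by (subst card_SigmaI)
      (auto simp: card_cartesian_product card_Pow card_subsets_binom finite_subset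
        intro!: sum.cong finite_cartesian_product)
  also have "\<dots> = (\<Sum>k=0..m. \<Sum>S | S \<subseteq> {..<m} \<and> card S = k.
      2 ^ card S * binom (n - i - 1) (int r - int (card S)))"
    by (subst sum_Pow_by_card) simp_all
  also have "\<dots> = (\<Sum>k=0..m. 2 ^ k * binom m (int k) * binom (n - i - 1) (int r - int k))"
    by (intro sum.cong) (auto simp: n_subsets binom_def)
  finally show ?thesis .
qed

section \<open>Reflection symmetry and the total size of the sumsets\<close>

lemma card_missing_sets_reflect:
  assumes "i \<le> 2 * (n - 1)" "n \<ge> 1"
  shows "card (missing_sets n r (2 * (n - 1) - i)) = card (missing_sets n r i)"
proof -
  let ?f = "\<lambda>x. n - 1 - x"
  \<comment> \<open>A representation of \<open>2 * (n - 1) - j\<close> by reflected elements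
    reflects back to one of \<open>j\<close>. Keeping \<open>j\<close> arbitrary gives both
    directions of the bijection, at \<open>i\<close> and at \<open>2 * (n - 1) - i\<close>.\<close>
  have f: "?f ` B \<in> missing_sets n r (2 * (n - 1) - j) \<and> ?f ` ?f ` B = B"
    if "B \<in> missing_sets n r j" "j \<le> 2 * (n - 1)" for B j
  proof -
    have B: "B \<subseteq> {..<n}" "card B = r" "j \<notin> B + B"
      using that by (auto simp: missing_sets_def)
    have inv: "?f (?f x) = x" if "x \<in> B" for x
      using that B by auto
    have "2 * (n - 1) - j \<notin> ?f ` B + ?f ` B"
    proof
      assume "2 * (n - 1) - j \<in> ?f ` B + ?f ` B"
      then obtain x y where xy: "x \<in> B" "y \<in> B" "2 * (n - 1) - j = ?f x + ?f y"
        by (auto simp: set_plus_def)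
      moreover from xy have "x < n" "y < n" using B by auto
      ultimately have "j = x + y" using that(2) by linarith
      then show False using xy B(3) by (auto simp: set_plus_def)
    qed
    moreover have "card (?f ` B) = r"
      using B(2) card_image[OF inj_on_inverseI[of B ?f ?f]] inv by simp
    moreover have "?f ` ?f ` B = B"
      using inv by (force simp: image_image)
    moreover have "?f ` B \<subseteq> {..<n}" using assms(2) by auto
    ultimately show ?thesis by (auto simp: missing_sets_def)
  qed
  show ?thesis
    using f[of _ i] f[of _ "2 * (n - 1) - i"] assms(1)
    by (intro bij_betw_same_card[where f = "image ?f"] bij_betw_byWitness[where f' = "image ?f"]) auto
qed

text \<open>The map sending \<open>i\<close> to \<open>2 * m - i\<close> exchanges the two halves of
  the range and fixes only the centre \<open>m\<close>, which is therefore counted once.\<close>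

lemma sum_symmetric:
  fixes f :: "nat \<Rightarrow> real"
  assumes "\<And>i. i \<le> 2 * m \<Longrightarrow> f (2 * m - i) = f i"
  shows "(\<Sum>i=0..2 * m. f i) = 2 * (\<Sum>i\<in>{0..<m}. f i) + f m"
proof -
  have "{0..2 * m} = {0..<m} \<union> {m} \<union> {m<..2 * m}" by auto
  then have "(\<Sum>i=0..2 * m. f i) = (\<Sum>i\<in>{0..<m}. f i) + f m + (\<Sum>i\<in>{m<..2 * m}. f i)"
    by (simp only:) (subst sum.union_disjoint; auto)+
  also have "(\<Sum>i\<in>{m<..2 * m}. f i) = (\<Sum>i\<in>{0..<m}. f i)"
    by (rule sum.reindex_bij_witness[where i = "\<lambda>i. 2 * m - i" and j = "\<lambda>i. 2 * m - i"])
      (auto simp: assms)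
  finally show ?thesis by simp
qed

text \<open>Double counting: \<open>card (B + B)\<close> is a sum of indicators over
  \<open>i \<le> 2 * (n - 1)\<close>. After swapping the sums, each \<open>i\<close> contributes the
  number of \<open>r\<close>-subsets that do not miss it, and reflection folds the range at
  \<open>n - 1\<close>.\<close>

lemma sum_card_sumset:
  assumes "n \<ge> 1"
  shows "(\<Sum>B | B \<subseteq> {..<n} \<and> card B = r. real (card (B + B))) =
    2 * (\<Sum>i\<in>{0..<n - 1}. real (n choose r) - card (missing_sets n r i))
    + (real (n choose r) - card (missing_sets n r (n - 1)))"
proof -
  let ?R = "{B. B \<subseteq> {..<n} \<and> card B = r}"
  have finR: "finite ?R" by simp
  have B: "real (card (B + B)) = (\<Sum>i=0..2 * (n - 1). if i \<in> B + B then 1 else 0)" if "B \<in> ?R" for B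
  proof -
    have "x + y \<le> 2 * (n - 1)" if "x \<in> B" "y \<in> B" for x y
    proof -
      have "x < n" "y < n" using that \<open>B \<in> ?R\<close> by auto
      then show ?thesis by linarith
    qed
    then have "B + B \<subseteq> {0..2 * (n - 1)}" by (auto simp: set_plus_def)
    then have "{0..2 * (n - 1)} \<inter> {i. i \<in> B + B} = B + B" by blast
    then show ?thesis by (simp add: sum.If_cases)
  qed
  have miss: "(\<Sum>B\<in>?R. if i \<in> B + B then 1 else 0) = real (n choose r) - card (missing_sets n r i)"
    for i
  proof -
    have "(\<Sum>B\<in>?R. if i \<in> B + B then 1 else 0) = (\<Sum>B\<in>?R. 1 - (if i \<notin> B + B then 1 else 0 :: real))"
      by (intro sum.cong) auto
    also have "\<dots> = real (card ?R) - card (?R \<inter> {B. i \<notin> B + B})"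
      using finR by (simp add: sum_subtractf sum.If_cases)
    also have "?R \<inter> {B. i \<notin> B + B} = missing_sets n r i"
      by (auto simp: missing_sets_def)
    finally show ?thesis by (simp add: n_subsets)
  qed
  have "(\<Sum>B\<in>?R. real (card (B + B))) =
      (\<Sum>i=0..2 * (n - 1). \<Sum>B\<in>?R. if i \<in> B + B then 1 else 0)"
    using B by (subst sum.swap) (intro sum.cong; simp)
  also have "\<dots> = (\<Sum>i=0..2 * (n - 1). real (n choose r) - card (missing_sets n r i))"
    by (simp only: miss)
  also have "\<dots> = 2 * (\<Sum>i\<in>{0..<n - 1}. real (n choose r) - card (missing_sets n r i))
    + (real (n choose r) - card (missing_sets n r (n - 1)))"
    using assms by (intro sum_symmetric) (simp only: card_missing_sets_reflect)
  finally show ?thesis .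
qed

theorem theorem1p1:
  fixes M :: "'a measure" and A :: "'a \<Rightarrow> nat set" and n :: nat and p q :: real
  assumes "n \<ge> 1"
    and "0 < p" "p < 1"
    and "q = 1 - p"
    and "prob_space M"
    and "\<And>\<omega>. \<omega> \<in> space M \<Longrightarrow> A \<omega> \<subseteq> {0..n - 1}"
    and "prob_space.indep_events M (\<lambda>i. {\<omega> \<in> space M. i \<in> A \<omega>}) {0..n - 1}"
    and "\<And>i. i \<in> {0..n - 1} \<Longrightarrow> measure M {\<omega> \<in> space M. i \<in> A \<omega>} = p"
  shows "(LINT \<omega>|M. real (card (A \<omega> + A \<omega>))) =
           (\<Sum>r=0..n. real (binom n (int r)) * p ^ r * q ^ (n - r) *
              (2 * (\<Sum>i\<in>{0..<n - 1}. 1 - missing_prob M A r i)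
               + (1 - missing_prob M A r (n - 1))))
       \<and> (\<forall>i\<in>{0..n - 1}. \<forall>r\<in>{0..n}.
            missing_prob M A r i =
              (if odd i
               then (\<Sum>k=0..(i + 1) div 2. 2 ^ k * real (binom ((i + 1) div 2) (int k))
                       * real (binom (n - i - 1) (int r - int k))) / real (binom n (int r))
               else (\<Sum>k=0..i div 2. 2 ^ k * real (binom (i div 2) (int k))
                       * real (binom (n - i - 1) (int r - int k))) / real (binom n (int r))))"
proof -
  interpret prob_space M by fact
  have I: "{0..n - 1} = {..<n}" using \<open>n \<ge> 1\<close> by auto
  note prems = finite_lessThan[of n] assms(6-8)[unfolded I]
  have binom: "binom n (int r) = n choose r" for r by (simp add: binom_def)
  have miss: "missing_prob M A r i = card (missing_sets n r i) / (n choose r)" for r i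
  proof -
    have "prob {\<omega> \<in> space M. card (A \<omega>) = r} = (n choose r) * (p ^ r * q ^ (n - r))"
      using prob_random_subset[OF prems, of "\<lambda>_. True" r] \<open>q = 1 - p\<close> by (simp add: n_subsets)
    moreover have "prob {\<omega> \<in> space M. i \<notin> A \<omega> + A \<omega> \<and> card (A \<omega>) = r} =
        card (missing_sets n r i) * (p ^ r * q ^ (n - r))"
      using prob_random_subset[OF prems, of "\<lambda>B. i \<notin> B + B" r] \<open>q = 1 - p\<close>
      by (simp add: missing_sets_def)
    \<comment> \<open>Since \<open>0 < p < 1\<close>, the common weight
      \<open>p ^ r * q ^ (n - r)\<close> is nonzero and cancels. For \<open>r > n\<close> both sides
      are quotients by 0, hence 0.\<close>
    ultimately show ?thesis
      using assms(2-4) by (simp add: missing_prob_def cond_prob_def)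
  qed
  have "(LINT \<omega>|M. real (card (A \<omega> + A \<omega>))) =
      (\<Sum>B\<in>Pow {..<n}. real (card (B + B)) * (p ^ card B * q ^ (n - card B)))"
    using expectation_random_subset[OF prems, of "\<lambda>B. real (card (B + B))"] \<open>q = 1 - p\<close> by simp
  also have "\<dots> = (\<Sum>r=0..n. \<Sum>B | B \<subseteq> {..<n} \<and> card B = r.
      real (card (B + B)) * (p ^ card B * q ^ (n - card B)))"
    by (subst sum_Pow_by_card) simp_all
  also have "\<dots> = (\<Sum>r=0..n. (p ^ r * q ^ (n - r)) *
      (\<Sum>B | B \<subseteq> {..<n} \<and> card B = r. real (card (B + B))))"
    by (simp add: sum_distrib_left mult_ac)
  also have "\<dots> = (\<Sum>r=0..n. real (binom n (int r)) * p ^ r * q ^ (n - r) *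
      (2 * (\<Sum>i\<in>{0..<n - 1}. 1 - missing_prob M A r i) + (1 - missing_prob M A r (n - 1))))"
  proof (intro sum.cong refl)
    fix r assume "r \<in> {0..n}"
    \<comment> \<open>For \<open>r \<le> n\<close> the binomial coefficient is nonzero, so the
      denominator in \<open>miss\<close> can be cleared.\<close>
    then have "real (n choose r) - card (missing_sets n r i) =
        real (n choose r) * (1 - missing_prob M A r i)" for i
      by (simp add: miss field_simps)
    then show "p ^ r * q ^ (n - r) * (\<Sum>B | B \<subseteq> {..<n} \<and> card B = r. real (card (B + B))) =
        real (binom n (int r)) * p ^ r * q ^ (n - r) *
        (2 * (\<Sum>i\<in>{0..<n - 1}. 1 - missing_prob M A r i) + (1 - missing_prob M A r (n - 1)))"
      using \<open>n \<ge> 1\<close>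
      by (simp only: sum_card_sumset binom flip: sum_distrib_left) (simp add: algebra_simps)
  qed
  finally have "(LINT \<omega>|M. real (card (A \<omega> + A \<omega>))) = \<dots>" .
  moreover have "missing_prob M A r i =
      (\<Sum>k=0..(i + 1) div 2. 2 ^ k * real (binom ((i + 1) div 2) (int k))
        * real (binom (n - i - 1) (int r - int k))) / real (binom n (int r))"
    if "i \<in> {0..n - 1}" for r i
    using that unfolding I by (simp add: miss card_missing_sets binom)
  \<comment> \<open>This turns the uniform formula with \<open>(i + 1) div 2\<close> into the even
    case of the claim.\<close>
  moreover have "(i + 1) div 2 = i div 2" if "even i" for i :: nat
    using that by simp
  ultimately show ?thesis by simp
qed

end
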